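(* Let $q\in\mathbb{C}$ with $0<|q|<1$, and fix a square root $q^{1/2}$ (with $q^{3/2}=q\cdot q^{1/2}$). Let $\alpha,\beta,\gamma\in\mathbb{C}^*$ satisfy $\alpha\beta^2=-1$ and $\beta\gamma=q$, and suppose $(\alpha\beta)^2\neq q^{2k}$ for all $k\in\mathbb{Z}$. Then for any $w\in\mathbb{C}^*$ with $\left|\frac{\gamma}{\alpha^2\beta}\right|<\left|\frac{\gamma w}{\alpha q^{1/2}}\right|<1$, $$ \frac{1}{2}\frac{(q;q^2)_\infty}{(q^2;q^2)_\infty} \left\{ \frac{\left(\frac{\gamma}{\alpha};q\right)_\infty}{(\alpha\beta;q)_\infty}\, {}_1\psi_1\!\left(\alpha\beta;\frac{\gamma}{\alpha};q,\frac{\gamma w}{\alpha q^{1/2}}\right) - \frac{(\beta^2\gamma;q)_\infty}{\left(\frac{1}{\beta};q\right)_\infty}\, {}_1\psi_1\!\left(\frac{1}{\beta};\beta^2\gamma;q,\frac{\gamma w}{\alpha q^{1/2}}\right) \right\} = \alpha\beta\, \frac{\left(\frac{\gamma}{\alpha^2\beta};q^2\right)_\infty}{(\alpha^2\beta^2;q^2)_\infty}\, \frac{\left(\frac{\alpha q^{1/2}}{\gamma w}q^2,\ \frac{\alpha\beta w}{q^{1/2}}q^2;\,q^2\right)_\infty}{\left(\frac{\gamma w q^{1/2}}{\alpha},\ \frac{q^{3/2}}{\alpha\beta w};\,q^2\right)_\infty}. $$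
   Context: For $0<|p|<1$, the $p$-shifted factorial is $(a;p)_0=1$; $(a;p)_n=(1-a)(1-ap)\cdots(1-ap^{n-1})$ for $n\ge1$; $(a;p)_n=\left[(1-ap^{-1})(1-ap^{-2})\cdots(1-ap^{n})\right]^{-1}$ for $n\le-1$. Also $(a;p)_\infty=\lim_{n\to\infty}(a;p)_n=\prod_{k\ge0}(1-ap^k)$ and $(a_1,\dots,a_m;p)_\infty=(a_1;p)_\infty\cdots(a_m;p)_\infty$. The bilateral basic hypergeometric series is $${}_1\psi_1(a;b;q,z)=\sum_{n\in\mathbb{Z}}\frac{(a;q)_n}{(b;q)_n}z^n,$$ which converges for $|b/a|<|z|<1$. *)

theory Defs
  imports "HOL-Analysis.Analysis"
begin

text \<open>The intended range of the base is \<open>0 < norm p < 1\<close>.\<close>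

definition qpoch :: "complex \<Rightarrow> complex \<Rightarrow> int \<Rightarrow> complex" where
  "qpoch a p n =
     (if n \<ge> 0 then (\<Prod>k<nat n. 1 - a * p ^ k)
      else inverse (\<Prod>k=1..nat (- n). 1 - a * p powi (- int k)))"

definition qpoch_inf :: "complex \<Rightarrow> complex \<Rightarrow> complex" where
  "qpoch_inf a p = (\<Prod>k. 1 - a * p ^ k)"

lemma qpoch_inf_LIMSEQ:
  assumes "norm p < 1"
  shows "(\<lambda>n. qpoch a p (int n)) \<longlonglongrightarrow> qpoch_inf a p"
proof -
  have "summable (\<lambda>k. norm a * norm p ^ k)"
    using assms by (intro summable_mult summable_geometric) simp
  then have "summable (\<lambda>k. norm ((1 - a * p ^ k) - 1))"
    by (simp add: norm_mult norm_power)
  then have "convergent_prod (\<lambda>k. 1 - a * p ^ k)"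
    by (intro abs_convergent_prod_imp_convergent_prod summable_imp_abs_convergent_prod)
  then have "(\<lambda>n. \<Prod>k\<le>n. 1 - a * p ^ k) \<longlonglongrightarrow> qpoch_inf a p"
    unfolding qpoch_inf_def by (rule convergent_prod_LIMSEQ)
  moreover have "(\<lambda>n. qpoch a p (int (Suc n))) = (\<lambda>n. \<Prod>k\<le>n. 1 - a * p ^ k)"
    by (rule ext) (simp only: qpoch_def of_nat_0_le_iff if_True nat_int lessThan_Suc_atMost)
  ultimately have "(\<lambda>n. qpoch a p (int (Suc n))) \<longlonglongrightarrow> qpoch_inf a p"
    by simp
  then show ?thesis
    by (rule LIMSEQ_imp_Suc)
qed

text \<open>Unconditional (equivalently, absolute) summation over the integers; the series converges
  absolutely for \<open>norm (b / a) < norm z < 1\<close> as long as no term has a pole.\<close>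

definition psi11 :: "complex \<Rightarrow> complex \<Rightarrow> complex \<Rightarrow> complex \<Rightarrow> complex" where
  "psi11 a b q z = (\<Sum>\<^sub>\<infinity>n\<in>(UNIV :: int set). qpoch a q n / qpoch b q n * z powi n)"

end

theory Submission
  imports Defs
begin

text \<open>
  Put \<open>a = \<alpha>\<beta>\<close> and \<open>z = \<gamma>w / (\<alpha>s)\<close>. The hypotheses give \<open>\<beta> = -1/a\<close>, \<open>\<alpha> = -a^2\<close>, \<open>\<gamma> = -qa\<close>, so the two series are
  \<open>psi11 c (q/c) q z\<close> with \<open>c = a\<close> and \<open>c = -a\<close>. Ramanujan's summation turns each of them into a common
  factor times \<open>\<theta>(cz) / \<theta>(c)\<close>, where \<open>\<theta>(x) = (x, q/x; q)\<close> as an infinite product. The difference of the two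
  quotients is evaluated by inserting the Jacobi triple product into \<open>\<theta>(az)\<theta>(-a) - \<theta>(-az)\<theta>(a)\<close>: only the
  terms whose indices \<open>i, j\<close> have odd sum survive, and with \<open>i = N + M\<close>, \<open>j = N - M + 1\<close> the double series factors
  into two theta series of base \<open>q^2\<close>.

  Both summations are limits of finite ones, with the summation index recentred at \<open>N\<close>: Ramanujan's of the
  \<open>q\<close>-Pfaff-Saalschuetz sum with \<open>A = aq^(-N)\<close>, \<open>B = b/(az)\<close>, \<open>n = 2N\<close>, Jacobi's of the \<open>q\<close>-binomial
  theorem. Tannery's theorem justifies the passage to the limit.
\<close>

section \<open>Finite shifted factorials and their reversal\<close>

definition qfac :: "complex \<Rightarrow> complex \<Rightarrow> nat \<Rightarrow> complex" where
  "qfac a q n = (\<Prod>k<n. 1 - a * q ^ k)"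

lemma qfac_0 [simp]: "qfac a q 0 = 1"
  by (simp add: qfac_def)

lemma qfac_Suc [simp]: "qfac a q (Suc n) = qfac a q n * (1 - a * q ^ n)"
  by (simp add: qfac_def)

lemma qfac_Suc_shift: "qfac a q (Suc n) = (1 - a) * qfac (a * q) q n"
  by (simp add: qfac_def prod.lessThan_Suc_shift power_Suc mult.assoc del: prod.lessThan_Suc)

lemma qfac_add: "qfac a q (m + n) = qfac a q m * qfac (a * q ^ m) q n"
  by (induction n) (simp_all add: power_add mult.assoc)

lemma qfac_eq_0_iff: "qfac a q n = 0 \<longleftrightarrow> (\<exists>k<n. a * q ^ k = 1)"
  by (auto simp: qfac_def)

text \<open>With j = n - k the factors on the left are 1 - a/q^j = -(a/q^j)(1 - q^j/a) for 1 <= j <=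
  n. The binomial coefficient is the sum of these j; keeping that power on the left leaves only
  natural exponents.\<close>

lemma qfac_reverse:
  assumes "q \<noteq> 0" "a \<noteq> 0"
  shows "qfac (a / q ^ n) q n * q ^ (Suc n choose 2) = qfac (q / a) q n * (- a) ^ n"
proof (induction n)
  case (Suc n)
  have "qfac (a / q ^ Suc n) q (Suc n) * q ^ (Suc (Suc n) choose 2)
      = (1 - a / q ^ Suc n) * q ^ Suc n * (qfac (a / q ^ n) q n * q ^ (Suc n choose 2))"
    using assms by (subst qfac_Suc_shift) (simp add: numeral_2_eq_2 power_add)
  also have "\<dots> = ((1 - a / q ^ Suc n) * q ^ Suc n) * (qfac (q / a) q n * (- a) ^ n)"
    by (simp only: Suc.IH)
  also have "(1 - a / q ^ Suc n) * q ^ Suc n = (1 - q / a * q ^ n) * (- a)"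
    using assms by (simp add: field_simps)
  finally show ?case by simp
qed (simp add: numeral_2_eq_2)

text \<open>In a quotient of two reversed products the powers of q cancel and a pure geometric
  factor remains.\<close>

lemma qfac_reverse_divide:
  assumes "q \<noteq> 0" "a \<noteq> 0" "b \<noteq> 0"
  shows "qfac (a / q ^ n) q n / qfac (b / q ^ n) q n = qfac (q / a) q n / qfac (q / b) q n * (a / b) ^ n"
proof -
  have "qfac (a / q ^ n) q n / qfac (b / q ^ n) q n =
     (qfac (a / q ^ n) q n * q ^ (Suc n choose 2)) / (qfac (b / q ^ n) q n * q ^ (Suc n choose 2))"
    using assms by simp
  also have "\<dots> = (qfac (q / a) q n * (- a) ^ n) / (qfac (q / b) q n * (- b) ^ n)"
    by (simp only: qfac_reverse assms(1,2,3) not_False_eq_True)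
  also have "\<dots> = qfac (q / a) q n / qfac (q / b) q n * ((- a) / (- b)) ^ n"
    by (simp only: power_divide times_divide_times_eq)
  finally show ?thesis by simp
qed

lemma qpoch_of_nat: "qpoch a q (int n) = qfac a q n"
  by (simp add: qpoch_def qfac_def)

lemma qpoch_minus_of_nat:
  assumes "q \<noteq> 0"
  shows "qpoch a q (- int n) = inverse (qfac (a / q ^ n) q n)"
proof -
  have "(\<Prod>k=1..n. 1 - a * q powi (- int k)) = qfac (a / q ^ n) q n"
  proof (induction n)
    case (Suc n)
    have "qfac (a / q ^ Suc n) q (Suc n) = (1 - a / q ^ Suc n) * qfac (a / q ^ n) q n"
      using assms by (subst qfac_Suc_shift) simp
    moreover have "q powi (- int (Suc n)) = 1 / q ^ Suc n"
      by (simp only: power_int_minus power_int_of_nat inverse_eq_divide)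
    ultimately show ?case
      by (simp only: prod.cl_ivl_Suc Suc.IH) simp
  qed simp
  then show ?thesis
    \<comment> \<open>\<open>n = 0\<close> is separate because \<open>qpoch\<close> puts index 0 in
      its first branch.\<close>
    by (cases n) (simp_all add: qpoch_def del: of_nat_Suc)
qed

text \<open>Recentring at n: \<open>qfac_add\<close> turns every index >= -n into an ordinary
  product started at \<open>a / q ^ n\<close>, over a divisor free of m. The values a = q^k with k
  >= 1 are those at which this divisor can vanish.\<close>

lemma qpoch_shift:
  assumes "q \<noteq> 0" "\<And>k. k \<ge> 1 \<Longrightarrow> a \<noteq> q ^ k"
  shows "qpoch a q (int m - int n) = qfac (a / q ^ n) q m / qfac (a / q ^ n) q n"
proof -
  have nz: "qfac (a / q ^ n) q n \<noteq> 0" 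
  proof
    assume "qfac (a / q ^ n) q n = 0"
    then obtain k where "k < n" "a / q ^ n * q ^ k = 1" by (auto simp: qfac_eq_0_iff)
    then have "a = q ^ (n - k)"
      using assms(1) by (simp add: power_diff field_simps)
    moreover have "n - k \<ge> 1" using \<open>k < n\<close> by simp
    ultimately show False using assms(2) by blast
  qed
  show ?thesis
  proof (cases "n \<le> m")
    case True
    then obtain d where d: "m = n + d" using le_Suc_ex by blast
    then have "int m - int n = int d" by simp
    then show ?thesis
      using nz assms(1) by (simp only: qpoch_of_nat) (simp add: d qfac_add)
  next
    case False
    then obtain d where d: "n = m + d" using le_Suc_ex by (metis nat_le_linear)
    then have "int m - int n = - int d" by simp
    then have "qpoch a q (int m - int n) = inverse (qfac (a / q ^ d) q d)"
      using qpoch_minus_of_nat[OF assms(1)] by simp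
    moreover have "qfac (a / q ^ n) q n = qfac (a / q ^ n) q m * qfac (a / q ^ d) q d"
      using assms(1) by (simp add: d qfac_add power_add)
    ultimately show ?thesis
      using nz by (simp add: field_simps)
  qed
qed

section \<open>Two terminating sums: q-Pfaff-Saalschuetz and q-binomial\<close>

text \<open>Rational core of the WZ step below, with u = q^k and v = q^(n-k), after the common
  factors of the summands are divided out.\<close>

lemma q_Saalschuetz_step:
  fixes A B z u v C q :: complex
  assumes "C = A * B * z" "1 - q * v \<noteq> 0"
  shows "(1 - q * (u * v)) * (1 - C * (u * v)) * ((1 - z * v) / (1 - q * v))
     - (1 - A * z * (u * v)) * (1 - B * z * (u * v))
     = v * (1 - u) * (q - C * u) * ((1 - z * v) / (1 - q * v)) - v * ((1 - A * u) * (1 - B * u) * z)"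
  using assms(2) unfolding assms(1) by (simp add: divide_simps) algebra

text \<open>The q-Pfaff-Saalschuetz sum as a convolution: its factors (q^(-n))_k / (q^(1-n)/z)_k are
  reversed into factors of index n - k, which removes q^(-n). Both sides obey the same first-order
  recurrence in n.\<close>

lemma q_Saalschuetz:
  assumes q: "q \<noteq> 0" "\<And>k. k \<ge> 1 \<Longrightarrow> q ^ k \<noteq> 1" and C: "C = A * B * z" "\<And>k. C * q ^ k \<noteq> 1"
  shows "(\<Sum>k\<le>n. qfac A q k * qfac B q k / (qfac q q k * qfac C q k) * z ^ k
           * (qfac z q (n - k) / qfac q q (n - k)))
       = qfac (A * z) q n * qfac (B * z) q n / (qfac q q n * qfac C q n)"
proof (induction n)
  case (Suc n)
  define P where "P k = qfac A q k * qfac B q k / (qfac q q k * qfac C q k) * z ^ k" for k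
  define R where "R m = qfac z q m / qfac q q m" for m
  \<comment> \<open>WZ certificate: \<open>G (Suc k) - G k\<close> is the summand of the recurrence in \<open>n\<close>, multiplied by \<open>q\<close> to avoid
    the exponent \<open>n - k\<close>, which would be truncated at \<open>k = n + 1\<close>.\<close>
  define G where "G k = - (q ^ (n + 1 - k) * ((1 - q ^ k) * (q - C * q ^ k)) * P k * R (n + 1 - k))"
    for k
  have qn: "1 - q * q ^ k \<noteq> 0" for k using q(2)[of "Suc k"] by simp
  have Cn: "1 - C * q ^ k \<noteq> 0" for k using C(2)[of k] by simp
  have PS: "P (Suc k) * ((1 - q * q ^ k) * (1 - C * q ^ k)) = P k * ((1 - A * q ^ k) * (1 - B * q ^ k) * z)" for k
    using qn[of k] Cn[of k] by (simp add: P_def divide_simps)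
  have RS: "R (Suc m) = R m * ((1 - z * q ^ m) / (1 - q * q ^ m))" for m
    by (simp add: R_def)
  have step: "q * ((1 - q * q ^ n) * (1 - C * q ^ n) * (P k * R (Suc n - k))
      - (1 - A * z * q ^ n) * (1 - B * z * q ^ n) * (P k * R (n - k))) = G (Suc k) - G k"
    if "k \<le> n" for k
  proof -
    define m where "m = n - k"
    have n: "n = k + m" using that by (simp add: m_def)
    define E where "E = (1 - z * q ^ m) / (1 - q * q ^ m)"
    have RE: "R (Suc m) = R m * E" by (simp add: RS E_def)
    have "G (Suc k) = - (q ^ m * (P (Suc k) * ((1 - q * q ^ k) * (1 - C * q ^ k))) * q * R m)"
      by (simp add: G_def n algebra_simps)
    then have G1: "G (Suc k) = - (q ^ m * (P k * ((1 - A * q ^ k) * (1 - B * q ^ k) * z)) * q * R m)"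
      unfolding PS .
    have G0: "G k = - (q ^ m * q * (1 - q ^ k) * (q - C * q ^ k) * P k * (R m * E))"
      by (simp add: G_def n Suc_diff_le RE mult_ac)
    note * = q_Saalschuetz_step[OF C(1) qn[of m], of "q ^ k", folded E_def]
    have "q * ((1 - q * q ^ n) * (1 - C * q ^ n) * (P k * R (Suc n - k))
      - (1 - A * z * q ^ n) * (1 - B * z * q ^ n) * (P k * R (n - k)))
      = q * P k * R m * ((1 - q * (q ^ k * q ^ m)) * (1 - C * (q ^ k * q ^ m)) * E
     - (1 - A * z * (q ^ k * q ^ m)) * (1 - B * z * (q ^ k * q ^ m)))"
      by (simp add: n Suc_diff_le RE power_add algebra_simps)
    also have "\<dots> = G (Suc k) - G k"
      unfolding * G1 G0 by (simp add: algebra_simps)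
    finally show ?thesis .
  qed
  define T where "T n = (\<Sum>k\<le>n. P k * R (n - k))" for n
  have "q * ((1 - q * q ^ n) * (1 - C * q ^ n) * (\<Sum>k\<le>n. P k * R (Suc n - k))
      - (1 - A * z * q ^ n) * (1 - B * z * q ^ n) * T n) = (\<Sum>k\<le>n. G (Suc k) - G k)"
    unfolding T_def sum_distrib_left sum_subtractf [symmetric] by (rule sum.cong) (use step in simp_all)
  also have "\<dots> = G (Suc n) - G 0"
    using sum_telescope[of "\<lambda>k. - G k" n] by (simp add: sum_subtractf)
  \<comment> \<open>\<open>G 0\<close> vanishes through \<open>1 - q ^ 0\<close>.
    \<open>G (Suc n)\<close> has \<open>R 0 = 1\<close> and is minus the weighted term k = n + 1
    that the sum lacks, so moving it across completes \<open>T (Suc n)\<close> and leaves a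
    homogeneous recurrence.\<close>
  also have "\<dots> = - (q * ((1 - q * q ^ n) * (1 - C * q ^ n) * P (Suc n)))"
    by (simp add: G_def R_def algebra_simps)
  finally have "q * ((1 - q * q ^ n) * (1 - C * q ^ n) * T (Suc n)) 
      = q * ((1 - A * z * q ^ n) * (1 - B * z * q ^ n) * T n)"
    by (simp add: T_def R_def algebra_simps)
  then have "(1 - q * q ^ n) * (1 - C * q ^ n) * T (Suc n) = (1 - A * z * q ^ n) * (1 - B * z * q ^ n) * T n"
    using q(1) by simp
  then have "T (Suc n) = (1 - A * z * q ^ n) * (1 - B * z * q ^ n) * T n / ((1 - q * q ^ n) * (1 - C * q ^ n))"
    using qn[of n] Cn[of n] by (simp add: eq_divide_eq mult.commute)
  moreover have "T n = qfac (A * z) q n * qfac (B * z) q n / (qfac q q n * qfac C q n)"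
    using Suc.IH unfolding T_def P_def R_def by simp
  moreover have "?case \<longleftrightarrow> T (Suc n) = qfac (A * z) q (Suc n) * qfac (B * z) q (Suc n) / (qfac q q (Suc n) * qfac C q (Suc n))"
    unfolding T_def P_def R_def ..
  ultimately show ?case by (simp add: mult_ac)
qed (simp)

text \<open>In 1 - q^(n+1) = (1 - q^(n+1-k)) + q^(n+1-k) (1 - q^k) each part cancels the last factor
  of one of the two factorials, so the sum for n + 1 reduces to two multiples of the sum for
  n.\<close>

lemma q_binomial:
  assumes "\<And>k. k \<ge> 1 \<Longrightarrow> q ^ k \<noteq> 1"
  shows "(\<Sum>k\<le>n. (- x) ^ k * q ^ (k choose 2) * (1 / qfac q q k * (1 / qfac q q (n - k)))) = qfac x q n / qfac q q n"
proof (induction n)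
  case (Suc n)
  define R where "R m = 1 / qfac q q m" for m
  define e where "e k = (- x) ^ k * q ^ (k choose 2)" for k
  have qn: "1 - q * q ^ k \<noteq> 0" for k using assms[of "Suc k"] by simp
  have RS: "(1 - q * q ^ m) * R (Suc m) = R m" for m
    using qn[of m] by (simp add: R_def)
  have eS: "e (Suc k) = - x * q ^ k * e k" for k
    by (simp add: e_def numeral_2_eq_2 power_add)
  define S where "S n = (\<Sum>k\<le>n. e k * (R k * R (n - k)))" for n
  have "(1 - q * q ^ n) * S (Suc n) =
    (\<Sum>k\<le>Suc n. e k * R k * ((1 - q ^ (Suc n - k)) * R (Suc n - k))) +
    (\<Sum>k\<le>Suc n. q ^ (Suc n - k) * e k * ((1 - q ^ k) * R k) * R (Suc n - k))"
    unfolding S_def sum_distrib_left sum.distrib [symmetric]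
  proof (rule sum.cong)
    fix k assume "k \<in> {..Suc n}"
    then have "q * q ^ n = q ^ (Suc n - k) * q ^ k"
      by (simp flip: power_Suc power_add)
    then show "(1 - q * q ^ n) * (e k * (R k * R (Suc n - k))) =
      e k * R k * ((1 - q ^ (Suc n - k)) * R (Suc n - k)) +
      q ^ (Suc n - k) * e k * ((1 - q ^ k) * R k) * R (Suc n - k)"
      by (simp add: algebra_simps)
  qed simp
  \<comment> \<open>The summand k = n + 1 drops out through 1 - q^0.\<close>
  also have "(\<Sum>k\<le>Suc n. e k * R k * ((1 - q ^ (Suc n - k)) * R (Suc n - k))) = S n"
    unfolding S_def by (simp add: Suc_diff_le RS mult.assoc)
  \<comment> \<open>Here the summand k = 0 drops out, and the rest is shifted by one.\<close>
  also have "(\<Sum>k\<le>Suc n. q ^ (Suc n - k) * e k * ((1 - q ^ k) * R k) * R (Suc n - k)) =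
     (\<Sum>k\<le>n. q ^ (n - k) * e (Suc k) * R k * R (n - k))"
    by (subst sum.atMost_Suc_shift) (simp add: RS)
  also have "\<dots> = (\<Sum>k\<le>n. - x * q ^ n * (e k * (R k * R (n - k))))"
  proof (rule sum.cong)
    fix k assume "k \<in> {..n}"
    then have "q ^ n = q ^ (n - k) * q ^ k"
      by (simp flip: power_add)
    then show "q ^ (n - k) * e (Suc k) * R k * R (n - k) = - x * q ^ n * (e k * (R k * R (n - k)))"
      by (simp add: eS)
  qed simp
  also have "\<dots> = - x * q ^ n * S n"
    by (simp only: S_def sum_distrib_left)
  finally have "(1 - q * q ^ n) * S (Suc n) = (1 - x * q ^ n) * S n"
    by (simp add: algebra_simps)
  then have "S (Suc n) = (1 - x * q ^ n) * S n / (1 - q * q ^ n)"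
    using qn[of n] by (simp add: eq_divide_eq mult.commute)
  moreover have "S n = qfac x q n / qfac q q n"
    using Suc.IH unfolding S_def e_def R_def .
  moreover have "?case \<longleftrightarrow> S (Suc n) = qfac x q (Suc n) / qfac q q (Suc n)"
    unfolding S_def e_def R_def ..
  ultimately show ?case by (simp add: mult_ac)
qed (simp add: numeral_2_eq_2)

section \<open>Infinite products and limits of bilateral sums\<close>

lemma qfac_LIMSEQ: "norm q < 1 \<Longrightarrow> qfac a q \<longlonglongrightarrow> qpoch_inf a q"
  using qpoch_inf_LIMSEQ[of q a] by (simp add: qpoch_of_nat)

lemma qfac_LIMSEQ_double:
  assumes "norm q < 1"
  shows "(\<lambda>n. qfac a q (n + n)) \<longlonglongrightarrow> qpoch_inf a q"
proof (rule filterlim_compose[OF qfac_LIMSEQ[OF assms]])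
  show "filterlim (\<lambda>n. n + n) sequentially (sequentially :: nat filter)"
    by (rule filterlim_at_top_mono[OF filterlim_ident]) simp
qed

lemma qpoch_inf_nonzero:
  assumes "norm q < 1" "\<And>k. a * q ^ k \<noteq> 1"
  shows "qpoch_inf a q \<noteq> 0"
proof -
  have "summable (\<lambda>k. norm a * norm q ^ k)"
    using assms by (intro summable_mult summable_geometric) simp
  then have "summable (\<lambda>k. norm ((1 - a * q ^ k) - 1))"
    by (simp add: norm_mult norm_power)
  then have "convergent_prod (\<lambda>k. 1 - a * q ^ k)"
    by (intro abs_convergent_prod_imp_convergent_prod summable_imp_abs_convergent_prod)
  then show ?thesis
    unfolding qpoch_inf_def by (rule prodinf_nonzero) (use assms(2) in auto)
qed

lemma power_neq_1_of_norm_less_1: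
  fixes q :: complex
  assumes "norm q < 1" "k \<ge> 1"
  shows "q ^ k \<noteq> 1"
proof
  assume "q ^ k = 1"
  then have "norm q ^ k = 1" by (metis norm_one norm_power)
  moreover have "norm q ^ k < 1" using assms by (simp add: power_less_one_iff)
  ultimately show False by simp
qed

lemma summable_on_int:
  fixes f :: "int \<Rightarrow> real"
  assumes "\<And>j. f j \<ge> 0" "summable (\<lambda>n. f (int n))" "summable (\<lambda>n. f (- int n))"
  shows "f summable_on UNIV"
proof -
  have "f summable_on range int"
    using assms by (subst summable_on_reindex) (simp_all add: o_def summable_on_UNIV_nonneg_real_iff)
  moreover have "f summable_on range (\<lambda>n. - int n)"
    using assms by (subst summable_on_reindex) (simp_all add: o_def inj_on_def summable_on_UNIV_nonneg_real_iff)
  ultimately have "f summable_on (range int \<union> range (\<lambda>n. - int n))"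
    by (rule summable_on_union)
  moreover have "range int \<union> range (\<lambda>n. - int n) = UNIV"
    by (auto simp: image_iff) (metis int_cases2)
  ultimately show ?thesis by simp
qed

text \<open>\<open>int_decode\<close> enumerates the integers, which brings bilateral sums within
  reach of Tannery's theorem for series over the naturals.\<close>

lemma infsum_int_decode:
  fixes g :: "int \<Rightarrow> complex"
  assumes "(\<lambda>j. norm (g j)) summable_on UNIV"
  shows "summable (\<lambda>k. norm (g (int_decode k)))" "(\<Sum>k. g (int_decode k)) = infsum g UNIV"
proof -
  have "(\<lambda>k. norm (g (int_decode k))) summable_on UNIV"
    using assms summable_on_reindex_bij_betw[OF bij_int_decode, of "\<lambda>j. norm (g j)"] by simp
  then show *: "summable (\<lambda>k. norm (g (int_decode k)))"
    by (simp add: summable_on_UNIV_nonneg_real_iff)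
  have "((\<lambda>k. g (int_decode k)) has_sum (\<Sum>k. g (int_decode k))) UNIV"
    using * by (intro norm_summable_imp_has_sum) (auto intro: summable_sums summable_norm_cancel)
  then have "infsum (\<lambda>k. g (int_decode k)) UNIV = (\<Sum>k. g (int_decode k))"
    by (rule infsumI)
  then show "(\<Sum>k. g (int_decode k)) = infsum g UNIV"
    using infsum_reindex_bij_betw[OF bij_int_decode, of g] by simp
qed

text \<open>Extended by zero outside [-N, N], each finite sum becomes a full series dominated by
  \<open>norm (t j) * K\<close> for every N, and each fixed j lies inside the range from some N
  on.\<close>

lemma tannery_int:
  fixes t :: "int \<Rightarrow> complex" and c :: "nat \<Rightarrow> int \<Rightarrow> complex"
  assumes t: "(\<lambda>j. norm (t j)) summable_on UNIV"
    and c: "\<And>N j. norm (c N j) \<le> K" "\<And>j. (\<lambda>N. c N j) \<longlonglongrightarrow> L"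
  shows "(\<lambda>N. \<Sum>j=- int N..int N. t j * c N j) \<longlonglongrightarrow> L * infsum t UNIV"
proof -
  define a where "a j N = (if j \<in> {- int N..int N} then t j * c N j else 0)" for j N
  have le: "norm (a j N) \<le> norm (t j) * K" for j N
  proof -
    have "norm (a j N) \<le> norm (t j) * norm (c N j)"
      by (simp add: a_def norm_mult)
    also have "\<dots> \<le> norm (t j) * K" by (intro mult_left_mono c) simp
    finally show ?thesis .
  qed
  have lim: "(\<lambda>N. a j N) \<longlonglongrightarrow> L * t j" for j
  proof -
    have "(\<lambda>N. t j * c N j) \<longlonglongrightarrow> t j * L" by (intro tendsto_intros c)
    moreover have "eventually (\<lambda>N. t j * c N j = a j N) sequentially"
      using eventually_ge_at_top[of "nat \<bar>j\<bar>"] by eventually_elim (auto simp: a_def)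
    ultimately show ?thesis
      by (simp add: mult.commute Lim_transform_eventually)
  qed
  have "(\<lambda>N. \<Sum>k. a (int_decode k) N) \<longlonglongrightarrow> (\<Sum>k. L * t (int_decode k))"
  proof (rule conjunct2[OF conjunct2[OF tannerys_theorem]])
    show "eventually (\<lambda>(k, N). norm (a (int_decode k) N) \<le> norm (t (int_decode k)) * K)
      (at_top \<times>\<^sub>F sequentially)"
      using le by (intro always_eventually) auto
    show "summable (\<lambda>k. norm (t (int_decode k)) * K)"
      by (intro summable_mult2 infsum_int_decode(1)[OF t])
  qed (use lim in auto)
  moreover have "(\<Sum>k. L * t (int_decode k)) = L * infsum t UNIV"
    using infsum_int_decode[OF t] by (simp add: suminf_mult summable_norm_cancel)
  moreover have "(\<Sum>k. a (int_decode k) N) = (\<Sum>j=- int N..int N. t j * c N j)" for N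
  proof -
    have "(\<lambda>j. norm (a j N)) summable_on UNIV"
      by (rule Infinite_Sum.abs_summable_on_comparison_test'[OF summable_on_cmult_left[OF t, of K]]) (rule le)
    then have "(\<Sum>k. a (int_decode k) N) = infsum (\<lambda>j. a j N) UNIV"
      by (rule infsum_int_decode(2))
    also have "\<dots> = infsum (\<lambda>j. t j * c N j) {- int N..int N}"
      by (rule infsum_cong_neutral) (auto simp: a_def)
    finally show ?thesis by simp
  qed
  ultimately show ?thesis by simp
qed

text \<open>The limiting shape shared by both summations. With k = N + j the weight is f (N + j) g
  (N - j); for fixed j both indices tend to infinity, so its limit does not depend on j.\<close>

lemma bilateral_convolution_limit:
  fixes t :: "int \<Rightarrow> complex" and f g :: "nat \<Rightarrow> complex"
  assumes t: "(\<lambda>j. norm (t j)) summable_on UNIV"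
    and f: "f \<longlonglongrightarrow> F" and g: "g \<longlonglongrightarrow> G"
  shows "(\<lambda>N. \<Sum>k\<le>N + N. t (int k - int N) * (f k * g (N + N - k))) \<longlonglongrightarrow> F * G * infsum t UNIV"
proof -
  have lim: "filterlim (\<lambda>N. nat (int N + j)) sequentially sequentially" for j
    unfolding filterlim_at_top
  proof
    fix Z show "eventually (\<lambda>N. Z \<le> nat (int N + j)) sequentially"
      using eventually_ge_at_top[of "Z + nat \<bar>j\<bar>"] by eventually_elim auto
  qed
  obtain K1 where K1: "\<And>n. norm (f n) \<le> K1"
    using convergent_imp_Bseq[OF convergentI[OF f]] by (auto simp: Bseq_def)
  obtain K2 where K2: "\<And>n. norm (g n) \<le> K2"
    using convergent_imp_Bseq[OF convergentI[OF g]] by (auto simp: Bseq_def)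
  have "(\<lambda>N. \<Sum>j=- int N..int N. t j * (f (nat (int N + j)) * g (nat (int N + - j)))) \<longlonglongrightarrow> F * G * infsum t UNIV"
  proof (rule tannery_int[OF t])
    \<comment> \<open>The bound must cover every j, also where \<open>nat\<close> truncates a
      negative index to 0; bounds on f and g at all natural indices do so.\<close>
    show "norm (f (nat (int N + j)) * g (nat (int N + - j))) \<le> K1 * K2" for N j
      unfolding norm_mult by (intro mult_mono K1 K2) (auto intro: order_trans[OF norm_ge_zero K1])
    show "(\<lambda>N. f (nat (int N + j)) * g (nat (int N + - j))) \<longlonglongrightarrow> F * G" for j
      by (intro tendsto_mult filterlim_compose[OF f lim] filterlim_compose[OF g lim])
  qed
  moreover have "(\<Sum>j=- int N..int N. t j * (f (nat (int N + j)) * g (nat (int N + - j))))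
     = (\<Sum>k\<le>N + N. t (int k - int N) * (f k * g (N + N - k)))" for N
    by (rule sum.reindex_bij_witness[of _ "\<lambda>k. int k - int N" "\<lambda>j. nat (int N + j)"])
       (auto simp: nat_diff_distrib intro!: arg_cong[of _ _ g])
  ultimately show ?thesis by simp
qed

section \<open>Ramanujan's bilateral summation\<close>

lemma mult_power_neq_1_of_norm_less_1:
  fixes q :: complex
  assumes "norm x < 1" "norm q < 1"
  shows "x * q ^ k \<noteq> 1"
proof
  assume "x * q ^ k = 1"
  then have "norm x * norm q ^ k = 1" by (metis norm_mult norm_one norm_power)
  moreover have "norm x * norm q ^ k \<le> norm x * 1"
    using assms(2) by (intro mult_left_mono power_le_one) auto
  ultimately show False using assms(1) by simp
qed

lemma summable_norm_Bseq_mult_geometric: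
  fixes c :: "nat \<Rightarrow> complex"
  assumes "c \<longlonglongrightarrow> L" "norm r < 1"
  shows "summable (\<lambda>n. norm (c n * r ^ n))"
proof -
  obtain K where K: "\<And>n. norm (c n) \<le> K"
    using convergent_imp_Bseq[OF convergentI[OF assms(1)]] by (auto simp: Bseq_def)
  show ?thesis
  proof (rule summable_comparison_test')
    show "summable (\<lambda>n. K * norm r ^ n)"
      using assms(2) by (intro summable_mult summable_geometric) simp
    show "norm (norm (c n * r ^ n)) \<le> K * norm r ^ n" for n
      by (simp add: norm_mult norm_power mult_right_mono K)
  qed
qed

text \<open>The first consequence permits recentring; the other two keep the infinite products of a
  and of q / a away from zero.\<close>

lemma powi_neq_imp_power_neq:
  fixes a q :: complex
  assumes "\<And>k :: int. a \<noteq> q powi k"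
  shows "a \<noteq> q ^ n" "a * q ^ n \<noteq> 1" "q / a * q ^ n \<noteq> 1"
proof -
  show "a \<noteq> q ^ n" using assms[of "int n"] by simp
  show "a * q ^ n \<noteq> 1"
  proof
    assume *: "a * q ^ n = 1"
    then have "a = inverse (q ^ n)" by (metis inverse_unique mult.commute)
    then show False using assms[of "- int n"] by (simp add: power_int_minus)
  qed
  show "q / a * q ^ n \<noteq> 1"
  proof
    assume "q / a * q ^ n = 1"
    moreover from this have "a \<noteq> 0" by auto
    ultimately have "a = q ^ Suc n" by (simp add: field_simps)
    then show False using assms[of "int (Suc n)"] by (metis power_int_of_nat)
  qed
qed

lemma Ramanujan_psi11:
  assumes q: "q \<noteq> 0" "norm q < 1"
    and nz: "a \<noteq> 0" "b \<noteq> 0" "z \<noteq> 0"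
    and a: "\<And>k :: int. a \<noteq> q powi k" and b: "\<And>k :: int. b \<noteq> q powi k"
    and z: "norm (b / a) < norm z" "norm z < 1"
  shows "psi11 a b q z =
    qpoch_inf q q * qpoch_inf (b / a) q * qpoch_inf (a * z) q * qpoch_inf (q / (a * z)) q /
    (qpoch_inf b q * qpoch_inf (q / a) q * qpoch_inf z q * qpoch_inf (b / (a * z)) q)"
proof -
  define t where "t j = qpoch a q j / qpoch b q j * z powi j" for j
  \<comment> \<open>\<open>B\<close> is the geometric ratio of the negative half of the series, as z
    is of the positive half; the annulus says that both have norm below 1.\<close>
  define B where "B = b / (a * z)"
  note lim = qfac_LIMSEQ[OF q(2)]
  note a' = powi_neq_imp_power_neq[OF a] and b' = powi_neq_imp_power_neq[OF b]
  have q1: "q ^ k \<noteq> 1" if "k \<ge> 1" for k using power_neq_1_of_norm_less_1[OF q(2) that] .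
  have q1': "q * q ^ k \<noteq> 1" for k using q1[of "Suc k"] by simp
  note norm_less = mult_power_neq_1_of_norm_less_1[OF _ q(2)]
  have B: "norm B < 1"
    using z nz by (simp add: B_def norm_divide norm_mult field_simps)
  have nz': "qpoch_inf q q \<noteq> 0" "qpoch_inf b q \<noteq> 0" "qpoch_inf a q \<noteq> 0" "qpoch_inf (q / a) q \<noteq> 0"
     "qpoch_inf z q \<noteq> 0" "qpoch_inf B q \<noteq> 0"
    by ((rule qpoch_inf_nonzero[OF q(2)];
         rule q1' a'(2,3) b'(2) norm_less[OF z(2)] norm_less[OF B]))+
  have "(\<lambda>j. norm (t j)) summable_on UNIV"
  proof (rule summable_on_int)
    have "(\<lambda>n. qfac a q n / qfac b q n) \<longlonglongrightarrow> qpoch_inf a q / qpoch_inf b q"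
      by (intro tendsto_divide lim nz')
    from summable_norm_Bseq_mult_geometric[OF this z(2)]
    show "summable (\<lambda>n. norm (t (int n)))"
      by (simp add: t_def qpoch_of_nat)
    \<comment> \<open>After reversal the negative half also consists of convergent coefficients
      times a geometric factor, now \<open>B ^ n\<close>.\<close>
    have "(\<lambda>n. qfac (q / b) q n / qfac (q / a) q n) \<longlonglongrightarrow> qpoch_inf (q / b) q / qpoch_inf (q / a) q"
      by (intro tendsto_divide lim nz')
    from summable_norm_Bseq_mult_geometric[OF this B]
    have "summable (\<lambda>n. norm (qfac (q / b) q n / qfac (q / a) q n * B ^ n))" .
    also have "(\<lambda>n. qfac (q / b) q n / qfac (q / a) q n * B ^ n) = (\<lambda>n. t (- int n))"
    proof
      fix n
      have "t (- int n) = qfac (b / q ^ n) q n / qfac (a / q ^ n) q n / z ^ n"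
        by (simp add: t_def qpoch_minus_of_nat[OF q(1)] power_int_minus divide_inverse mult_ac)
      also have "\<dots> = qfac (q / b) q n / qfac (q / a) q n * B ^ n"
        by (simp add: qfac_reverse_divide q nz B_def power_divide power_mult_distrib)
      finally show "qfac (q / b) q n / qfac (q / a) q n * B ^ n = t (- int n)" by simp
    qed
    finally show "summable (\<lambda>n. norm (t (- int n)))" .
  qed simp
  \<comment> \<open>These weights make the recentred partial sums summable in closed form; in the
    limit they contribute only a constant.\<close>
  then have "(\<lambda>N. \<Sum>k\<le>N + N. t (int k - int N) * (qfac B q k / qfac q q k * (qfac z q (N + N - k) / qfac q q (N + N - k))))
     \<longlonglongrightarrow> (qpoch_inf B q / qpoch_inf q q) * (qpoch_inf z q / qpoch_inf q q) * infsum t UNIV"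
    by (rule bilateral_convolution_limit) (intro tendsto_divide lim nz')+
  also have "(\<lambda>N. \<Sum>k\<le>N + N. t (int k - int N) * (qfac B q k / qfac q q k * (qfac z q (N + N - k) / qfac q q (N + N - k))))
    = (\<lambda>N. qfac (q / (a * z)) q N * qfac (a * z) q N * qfac (b / a) q (N + N) /
         (qfac (q / a) q N * qfac b q N * qfac q q (N + N)))"
  proof
    fix N
    \<comment> \<open>The parameters moved N steps back. The balancing condition
      \<open>C = A * B * z\<close> holds for every N, which is why \<open>B\<close> is b / (a
      z).\<close>
    define A C where "A = a / q ^ N" and "C = b / q ^ N"
    have C: "C = A * B * z" using nz by (simp add: A_def B_def C_def)
    have C1: "C * q ^ k \<noteq> 1" for k
    proof
      assume "C * q ^ k = 1"
      then have "b = q powi (int N - int k)"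
        using q(1) by (simp add: C_def power_int_diff field_simps)
      then show False using b by blast
    qed
    have CN: "qfac C q n \<noteq> 0" for n using C1 by (auto simp: qfac_eq_0_iff)
    have AN: "qfac A q N \<noteq> 0"
    proof
      assume "qfac A q N = 0"
      then obtain k where "A * q ^ k = 1" by (auto simp: qfac_eq_0_iff)
      then have "a = q powi (int N - int k)"
        using q(1) by (simp add: A_def power_int_diff field_simps)
      then show False using a by blast
    qed
    \<comment> \<open>All that depends on N alone collects in front of the Saalschuetz
      summand.\<close>
    have t: "t (int k - int N) = qfac C q N / (qfac A q N * z ^ N) * (qfac A q k / qfac C q k * z ^ k)" for k
      using nz(3) by (simp add: t_def qpoch_shift q(1) a' b' A_def[symmetric] C_def[symmetric] power_int_diff mult_ac)
    have "(\<Sum>k\<le>N + N. t (int k - int N) * (qfac B q k / qfac q q k * (qfac z q (N + N - k) / qfac q q (N + N - k))))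
      = qfac C q N / (qfac A q N * z ^ N) * (\<Sum>k\<le>N+N. qfac A q k * qfac B q k / (qfac q q k * qfac C q k) * z ^ k
           * (qfac z q (N + N - k) / qfac q q (N + N - k)))"
      unfolding sum_distrib_left by (rule sum.cong) (simp_all add: t mult_ac)
    also have "\<dots> = qfac C q N / (qfac A q N * z ^ N) *
       (qfac (A * z) q (N + N) * qfac (B * z) q (N + N) / (qfac q q (N + N) * qfac C q (N + N)))"
      by (subst q_Saalschuetz[OF q(1) q1 C C1]) simp_all
    \<comment> \<open>The products of length 2N are cut at N: the upper halves no longer contain the
      shift, \<open>qfac C q N\<close> cancels, and the remaining lower halves get reversed.\<close>
    also have "qfac C q (N + N) = qfac C q N * qfac b q N"
      by (simp add: qfac_add C_def q(1))
    also have "qfac (A * z) q (N + N) = qfac (a * z / q ^ N) q N * qfac (a * z) q N"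
      by (simp add: qfac_add A_def q(1))
    also have "B * z = b / a" using nz by (simp add: B_def)
    also have "qfac C q N / (qfac A q N * z ^ N) *
       (qfac (a * z / q ^ N) q N * qfac (a * z) q N * qfac (b / a) q (N + N) / (qfac q q (N + N) * (qfac C q N * qfac b q N)))
      = (qfac (a * z / q ^ N) q N / qfac (a / q ^ N) q N) / z ^ N * (qfac (a * z) q N * qfac (b / a) q (N + N) / (qfac q q (N + N) * qfac b q N))"
      using CN by (simp add: A_def field_simps)
    also have "(qfac (a * z / q ^ N) q N / qfac (a / q ^ N) q N) / z ^ N = qfac (q / (a * z)) q N / qfac (q / a) q N"
      using nz by (simp add: qfac_reverse_divide q)
    finally show "(\<Sum>k\<le>N + N. t (int k - int N) * (qfac B q k / qfac q q k * (qfac z q (N + N - k) / qfac q q (N + N - k))))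
      = qfac (q / (a * z)) q N * qfac (a * z) q N * qfac (b / a) q (N + N) /
         (qfac (q / a) q N * qfac b q N * qfac q q (N + N))"
      by (simp add: mult_ac)
  qed
  finally have L1: "(\<lambda>N. qfac (q / (a * z)) q N * qfac (a * z) q N * qfac (b / a) q (N + N) /
         (qfac (q / a) q N * qfac b q N * qfac q q (N + N)))
     \<longlonglongrightarrow> (qpoch_inf B q / qpoch_inf q q) * (qpoch_inf z q / qpoch_inf q q) * infsum t UNIV" .
  note lim2 = qfac_LIMSEQ_double[OF q(2)]
  have "(\<lambda>N. qfac (q / (a * z)) q N * qfac (a * z) q N * qfac (b / a) q (N + N) /
         (qfac (q / a) q N * qfac b q N * qfac q q (N + N)))
     \<longlonglongrightarrow> qpoch_inf (q / (a * z)) q * qpoch_inf (a * z) q * qpoch_inf (b / a) q / (qpoch_inf (q / a) q * qpoch_inf b q * qpoch_inf q q)"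
    by (intro tendsto_intros lim lim2) (use nz' in auto)
  from LIMSEQ_unique[OF L1 this] have
    "(qpoch_inf B q / qpoch_inf q q) * (qpoch_inf z q / qpoch_inf q q) * infsum t UNIV =
     qpoch_inf (q / (a * z)) q * qpoch_inf (a * z) q * qpoch_inf (b / a) q / (qpoch_inf (q / a) q * qpoch_inf b q * qpoch_inf q q)" .
  moreover have "psi11 a b q z = infsum t UNIV"
    unfolding psi11_def t_def ..
  ultimately show ?thesis
    using nz' unfolding B_def[symmetric] by (simp add: field_simps)
qed

section \<open>Theta series and the Jacobi triple product\<close>

text \<open>The division in the exponent is exact.\<close>

definition theta_term :: "complex \<Rightarrow> complex \<Rightarrow> int \<Rightarrow> complex" where
  "theta_term q x j = q powi (j * (j - 1) div 2) * (- x) powi j"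

lemma theta_term_add_1:
  assumes "q \<noteq> 0" "x \<noteq> 0"
  shows "theta_term q x (j + 1) = theta_term q x j * (- x * q powi j)"
proof -
  have "(j + 1) * (j + 1 - 1) = j * (j - 1) + 2 * j" by (simp add: algebra_simps)
  then have "(j + 1) * (j + 1 - 1) div 2 = j * (j - 1) div 2 + j" by simp
  then show ?thesis
    using assms by (simp add: theta_term_def power_int_add)
qed

text \<open>Induction from index -N, where j(j-1)/2 = N(N+1)/2, needs only the one-step recurrence.
  The last bracket is the q-binomial weight at \<open>x / q ^ N\<close>; the factor before it is
  free of k.\<close>

lemma theta_term_shift:
  assumes "q \<noteq> 0" "x \<noteq> 0"
  shows "theta_term q x (int k - int N) =
    q ^ (Suc N choose 2) / (- x) ^ N * ((- (x / q ^ N)) ^ k * q ^ (k choose 2))"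
proof (induction k)
  case 0
  have "(- int N) * (- int N - 1) = int (Suc N * N)" by (simp add: algebra_simps)
  then have "(- int N) * (- int N - 1) div 2 = int (Suc N choose 2)"
    by (simp add: choose_two zdiv_int)
  then have "q powi ((- int N) * (- int N - 1) div 2) = q ^ (Suc N choose 2)"
    by (simp only: power_int_of_nat)
  then have "theta_term q x (- int N) = q ^ (Suc N choose 2) / (- x) ^ N"
    by (simp only: theta_term_def power_int_minus power_int_of_nat divide_inverse)
  then show ?case
    by (simp add: numeral_2_eq_2)
next
  case (Suc k)
  have "theta_term q x (int (Suc k) - int N) = theta_term q x ((int k - int N) + 1)"
    by (simp add: algebra_simps)
  also have "\<dots> = theta_term q x (int k - int N) * (- x * q powi (int k - int N))"
    using assms by (rule theta_term_add_1)
  also have "q powi (int k - int N) = q ^ k / q ^ N"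
    using assms by (simp add: power_int_diff)
  finally show ?case
    by (simp add: Suc.IH numeral_2_eq_2 power_add)
qed

text \<open>The ratio y q^n tends to 0, so the ratio test applies. The two halves of the theta
  series have this form with y = -x and y = -q/x.\<close>

lemma summable_norm_of_q_recurrence:
  fixes f :: "nat \<Rightarrow> complex"
  assumes "norm q < 1" "\<And>n. f (Suc n) = f n * (y * q ^ n)"
  shows "summable (\<lambda>n. norm (f n))"
proof -
  have "(\<lambda>n. norm y * norm q ^ n) \<longlonglongrightarrow> norm y * 0"
    using assms(1) by (intro tendsto_intros LIMSEQ_power_zero) auto
  then have "eventually (\<lambda>n. norm y * norm q ^ n < 1 / 2) sequentially"
    by (rule order_tendstoD) simp
  then obtain N where N: "\<And>n. n \<ge> N \<Longrightarrow> norm y * norm q ^ n < 1 / 2"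
    by (auto simp: eventually_at_top_linorder)
  show ?thesis
  proof (rule summable_ratio_test[of "1 / 2" N])
    fix n assume "n \<ge> N"
    have "norm (f (Suc n)) = norm (f n) * (norm y * norm q ^ n)"
      by (simp add: assms(2) norm_mult norm_power)
    also have "\<dots> \<le> norm (f n) * (1 / 2)"
      using N[OF \<open>n \<ge> N\<close>] by (intro mult_left_mono) auto
    finally show "norm (norm (f (Suc n))) \<le> 1 / 2 * norm (norm (f n))" by simp
  qed simp
qed

lemma theta_term_abs_summable:
  assumes "q \<noteq> 0" "norm q < 1" "x \<noteq> 0"
  shows "(\<lambda>j. norm (theta_term q x j)) summable_on UNIV"
proof (rule summable_on_int)
  have "theta_term q x (int (Suc n)) = theta_term q x (int n) * (- x * q ^ n)" for n
    using theta_term_add_1[OF assms(1,3), of "int n"] by (simp add: add.commute)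
  then show "summable (\<lambda>n. norm (theta_term q x (int n)))"
    by (rule summable_norm_of_q_recurrence[OF assms(2)])
  have "theta_term q x (- int (Suc n)) = theta_term q x (- int n) * (- q / x * q ^ n)" for n
  proof -
    have "- int n = - int (Suc n) + 1" by simp
    then have "theta_term q x (- int n) = theta_term q x (- int (Suc n)) * (- x * q powi (- int (Suc n)))"
      using theta_term_add_1[OF assms(1,3)] by metis
    also have "q powi (- int (Suc n)) = 1 / (q * q ^ n)"
      by (simp only: power_int_minus power_int_of_nat inverse_eq_divide power_Suc)
    finally show ?thesis using assms(1,3) by (simp add: field_simps)
  qed
  then show "summable (\<lambda>n. norm (theta_term q x (- int n)))"
    by (rule summable_norm_of_q_recurrence[OF assms(2)])
qed simp

text \<open>At x / q^N with n = 2N the q-binomial product splits into \<open>qfac x q N\<close> and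
  a half that reverses to \<open>qfac (q / x) q N\<close>. The weights tend to 1/(q;q)^2 and the
  closed form carries 1/(q;q), so one factor (q;q) remains.\<close>

lemma Jacobi_triple_product:
  assumes q: "q \<noteq> 0" "norm q < 1" and x: "x \<noteq> 0"
  shows "infsum (theta_term q x) UNIV = qpoch_inf q q * qpoch_inf x q * qpoch_inf (q / x) q"
proof -
  note lim = qfac_LIMSEQ[OF q(2)]
  have q1: "q ^ k \<noteq> 1" if "k \<ge> 1" for k using power_neq_1_of_norm_less_1[OF q(2) that] .
  have nz: "qpoch_inf q q \<noteq> 0"
    using q1[of "Suc _"] by (intro qpoch_inf_nonzero q) simp
  have "(\<lambda>N. \<Sum>k\<le>N + N. theta_term q x (int k - int N) * (1 / qfac q q k * (1 / qfac q q (N + N - k))))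
     \<longlonglongrightarrow> (1 / qpoch_inf q q) * (1 / qpoch_inf q q) * infsum (theta_term q x) UNIV"
    by (rule bilateral_convolution_limit theta_term_abs_summable q x tendsto_divide lim nz tendsto_const)+
  also have "(\<lambda>N. \<Sum>k\<le>N + N. theta_term q x (int k - int N) * (1 / qfac q q k * (1 / qfac q q (N + N - k))))
    = (\<lambda>N. qfac (q / x) q N * qfac x q N / qfac q q (N + N))"
  proof
    fix N
    have "(\<Sum>k\<le>N + N. theta_term q x (int k - int N) * (1 / qfac q q k * (1 / qfac q q (N + N - k)))) =
      q ^ (Suc N choose 2) / (- x) ^ N *
        (\<Sum>k\<le>N + N. (- (x / q ^ N)) ^ k * q ^ (k choose 2) * (1 / qfac q q k * (1 / qfac q q (N + N - k))))"
      unfolding sum_distrib_left by (rule sum.cong) (simp_all add: theta_term_shift q x)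
    also have "\<dots> = q ^ (Suc N choose 2) / (- x) ^ N * (qfac (x / q ^ N) q (N + N) / qfac q q (N + N))"
      by (subst q_binomial[OF q1]) simp_all
    also have "qfac (x / q ^ N) q (N + N) = qfac (x / q ^ N) q N * qfac x q N"
      by (simp add: qfac_add q)
    \<comment> \<open>The prefactor left by recentring is exactly the one that reversal
      absorbs.\<close>
    also have "q ^ (Suc N choose 2) / (- x) ^ N * (qfac (x / q ^ N) q N * qfac x q N / qfac q q (N + N))
      = (qfac (x / q ^ N) q N * q ^ (Suc N choose 2)) / (- x) ^ N * (qfac x q N / qfac q q (N + N))"
      by simp
    also have "\<dots> = qfac (q / x) q N * qfac x q N / qfac q q (N + N)"
      by (subst qfac_reverse[OF q(1) x]) (use x in simp)
    finally show "(\<Sum>k\<le>N + N. theta_term q x (int k - int N) * (1 / qfac q q k * (1 / qfac q q (N + N - k)))) = \<dots>" .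
  qed
  finally have L1: "(\<lambda>N. qfac (q / x) q N * qfac x q N / qfac q q (N + N)) \<longlonglongrightarrow>
    (1 / qpoch_inf q q) * (1 / qpoch_inf q q) * infsum (theta_term q x) UNIV" .
  note lim2 = qfac_LIMSEQ_double[OF q(2)]
  have "(\<lambda>N. qfac (q / x) q N * qfac x q N / qfac q q (N + N)) \<longlonglongrightarrow>
     qpoch_inf (q / x) q * qpoch_inf x q / qpoch_inf q q"
    by (intro tendsto_intros lim lim2 nz)
  from LIMSEQ_unique[OF L1 this] show ?thesis
    using nz by (simp add: field_simps)
qed

section \<open>The quadratic theta identity\<close>

text \<open>Makes a product of two theta series one unordered double sum, open to restriction and
  reindexing.\<close>

lemma has_sum_mult_Times:
  fixes f :: "'a \<Rightarrow> complex" and g :: "'b \<Rightarrow> complex"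
  assumes f: "(\<lambda>x. norm (f x)) summable_on A" and g: "(\<lambda>y. norm (g y)) summable_on B"
  shows "((\<lambda>(x, y). f x * g y) has_sum (infsum f A * infsum g B)) (A \<times> B)"
proof -
  have "(\<lambda>(x, y). f x * g y) summable_on A \<times> B"
  proof (rule abs_summable_summable)
    show "(\<lambda>p. norm (case p of (x, y) \<Rightarrow> f x * g y)) summable_on A \<times> B"
      unfolding Infinite_Sum.abs_summable_on_Sigma_iff
      using f g by (simp add: norm_mult infsum_cmult_right' summable_on_cmult_right summable_on_cmult_left
          abs_mult infsum_nonneg abs_of_nonneg)
  qed
  then have "((\<lambda>(x, y). f x * g y) has_sum (infsum (\<lambda>(x, y). f x * g y) (A \<times> B))) (A \<times> B)"
    by (rule has_sum_infsum)
  moreover have "infsum (\<lambda>(x, y). f x * g y) (A \<times> B) = infsum f A * infsum g B"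
    using infsum_Sigma'_banach[OF \<open>(\<lambda>(x, y). f x * g y) summable_on A \<times> B\<close>]
    by (simp add: infsum_cmult_right' infsum_cmult_left')
  ultimately show ?thesis by simp
qed

lemma two_times_int_choose_2: "2 * (j * (j - 1) div 2) = j * (j - 1)" for j :: int
  by simp

text \<open>All signs are collected in the last bracket, which vanishes for even i + j.\<close>

lemma theta_term_mult_neg:
  "theta_term q x i * theta_term q (- y) j - theta_term q (- x) i * theta_term q y j =
     q powi (i * (i - 1) div 2) * q powi (j * (j - 1) div 2) * (x powi i * y powi j) *
       ((- 1) powi i - (- 1) powi j)"
proof -
  have "(- u) powi k = (- 1) powi k * u powi k" for u :: complex and k
    using power_int_mult_distrib[of "- 1" u k] by simp
  from this[of x] this[of y] show ?thesis
    by (simp add: theta_term_def algebra_simps)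
qed

text \<open>For i = N + M and j = N - M + 1 the mixed term cancels in i(i-1)/2 + j(j-1)/2 = M(M-1) +
  N(N-1) + N, so the variables separate. The powers q^N, a^(2N), z^N form the argument q a^2 z; the
  2 comes from the opposite signs for i and j.\<close>

lemma theta_term_mult_odd:
  assumes "q \<noteq> 0" "a \<noteq> 0" "z \<noteq> 0"
  shows "theta_term q (a * z) (N + M) * theta_term q (- a) (N - M + 1)
        - theta_term q (- (a * z)) (N + M) * theta_term q a (N - M + 1)
      = 2 * a * (theta_term (q ^ 2) z M * theta_term (q ^ 2) (q * a ^ 2 * z) N)"
proof -
  have neg: "(- u) powi k = (- 1) powi k * u powi k" for u :: complex and k
    using power_int_mult_distrib[of "- 1" u k] by simp
  have sq: "(u ^ 2) powi k = u powi (2 * k)" for u :: complex and k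
    by (simp add: power_int_mult)
  \<comment> \<open>Doubling clears the integer divisions before the exponents are compared.\<close>
  have "2 * ((N + M) * (N + M - 1) div 2 + (N - M + 1) * (N - M + 1 - 1) div 2)
      = 2 * (2 * (M * (M - 1) div 2) + 2 * (N * (N - 1) div 2) + N)"
    unfolding distrib_left two_times_int_choose_2 by (simp add: algebra_simps)
  then have e: "(N + M) * (N + M - 1) div 2 + (N - M + 1) * (N - M + 1 - 1) div 2
      = 2 * (M * (M - 1) div 2) + 2 * (N * (N - 1) div 2) + N"
    by (rule mult_left_cancel[THEN iffD1, rotated]) simp
  have Q: "q powi ((N + M) * (N + M - 1) div 2) * q powi ((N - M + 1) * (N - M + 1 - 1) div 2)
    = (q ^ 2) powi (M * (M - 1) div 2) * (q ^ 2) powi (N * (N - 1) div 2) * q powi N"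
    unfolding sq power_int_add[OF disjI1[OF assms(1)], symmetric] e ..
  have m1: "(- 1 :: complex) powi (N - M + 1) = - ((- 1) powi (N + M))"
    by (simp add: power_int_minus_left)
  have m2: "(- 1 :: complex) powi (N + M) = (- 1) powi N * (- 1) powi M"
    by (simp add: power_int_add)
  have X: "(a * z) powi (N + M) * a powi (N - M + 1) = a * (a powi (2 * N) * z powi N * z powi M)"
  proof -
    have "a powi (N + M) * a powi (N - M + 1) = a powi (2 * N + 1)"
      using assms by (simp flip: power_int_add)
    also have "\<dots> = a powi (2 * N) * a"
      using assms by (subst power_int_add) auto
    finally show ?thesis
      using assms by (simp add: power_int_mult_distrib power_int_add mult_ac)
  qed
  have "theta_term (q ^ 2) z M * theta_term (q ^ 2) (q * a ^ 2 * z) N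
    = ((q ^ 2) powi (M * (M - 1) div 2) * (q ^ 2) powi (N * (N - 1) div 2) * q powi N)
      * (a powi (2 * N) * z powi N * z powi M) * (- 1) powi (N + M)"
    unfolding theta_term_def neg[of z] neg[of "q * a ^ 2 * z"] power_int_mult_distrib sq[of a]
    by (simp add: m2 mult_ac)
  then show ?thesis
    unfolding theta_term_mult_neg Q X m1 by (simp add: mult_ac)
qed

lemma theta_quadratic:
  fixes q a z :: complex
  assumes q: "q \<noteq> 0" "norm q < 1" and nz: "a \<noteq> 0" "z \<noteq> 0"
  defines "\<Theta> \<equiv> \<lambda>q x. infsum (theta_term q x) UNIV"
  shows "\<Theta> q (a * z) * \<Theta> q (- a) - \<Theta> q (- (a * z)) * \<Theta> q a
    = 2 * a * (\<Theta> (q ^ 2) z * \<Theta> (q ^ 2) (q * a ^ 2 * z))"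
proof -
  define D where "D = (\<lambda>(i, j). theta_term q (a * z) i * theta_term q (- a) j
     - theta_term q (- (a * z)) i * theta_term q a j)"
  define E where "E = (\<lambda>(M, N). 2 * a * (theta_term (q ^ 2) z M * theta_term (q ^ 2) (q * a ^ 2 * z) N))"
  have q2: "q ^ 2 \<noteq> 0" "norm (q ^ 2) < 1"
    using q by (simp_all add: norm_power power_less_one_iff)
  have m1: "(- 1 :: complex) powi k = (if even k then 1 else - 1)" for k
    by (simp add: power_int_minus_left)
  have prod: "((\<lambda>(i, j). theta_term q x i * theta_term q y j) has_sum (\<Theta> q x * \<Theta> q y)) UNIV"
    if "x \<noteq> 0" "y \<noteq> 0" "q \<noteq> 0" "norm q < 1" for q x y
    using has_sum_mult_Times[of "theta_term q x" UNIV "theta_term q y" UNIV] that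
    by (simp add: \<Theta>_def theta_term_abs_summable)
  have "((\<lambda>p. (case p of (i, j) \<Rightarrow> theta_term q (a * z) i * theta_term q (- a) j)
      + - 1 * (case p of (i, j) \<Rightarrow> theta_term q (- (a * z)) i * theta_term q a j))
      has_sum (\<Theta> q (a * z) * \<Theta> q (- a) + - 1 * (\<Theta> q (- (a * z)) * \<Theta> q a))) UNIV"
    by (intro has_sum_add has_sum_cmult_right prod) (use q nz in auto)
  then have "(D has_sum (\<Theta> q (a * z) * \<Theta> q (- a) - \<Theta> q (- (a * z)) * \<Theta> q a)) UNIV"
    by (simp add: D_def case_prod_unfold)
  also have "?this \<longleftrightarrow> (D has_sum (\<Theta> q (a * z) * \<Theta> q (- a) - \<Theta> q (- (a * z)) * \<Theta> q a)) {(i, j). odd (i + j)}"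
    by (intro has_sum_cong_neutral)
       (auto simp: D_def theta_term_mult_neg m1 split: if_splits)
  also have "\<dots> \<longleftrightarrow> (E has_sum (\<Theta> q (a * z) * \<Theta> q (- a) - \<Theta> q (- (a * z)) * \<Theta> q a)) UNIV"
  \<comment> \<open>Both halvings are exact because i + j is odd: i + j = 2k + 1 gives N = k and M =
    i - k.\<close>
  proof (rule sym, rule has_sum_reindex_bij_witness[where j = "\<lambda>(M, N). (N + M, N - M + 1)"
          and i = "\<lambda>(i, j). ((i - j + 1) div 2, (i + j - 1) div 2)"])
    fix p :: "int \<times> int" assume "p \<in> {(i, j). odd (i + j)}"
    then obtain i j where p: "p = (i, j)" and "odd (i + j)" by auto
    then obtain k where "i + j = 2 * k + 1" by (elim oddE)
    then have j: "j = 2 * k + 1 - i" by simp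
    show "(case case p of (i, j) \<Rightarrow> ((i - j + 1) div 2, (i + j - 1) div 2) of
        (M, N) \<Rightarrow> (N + M, N - M + 1)) = p"
      unfolding p j by simp
  qed (auto simp: D_def E_def theta_term_mult_odd q nz)
  finally have "(E has_sum (\<Theta> q (a * z) * \<Theta> q (- a) - \<Theta> q (- (a * z)) * \<Theta> q a)) UNIV" .
  moreover have "(E has_sum (2 * a * (\<Theta> (q ^ 2) z * \<Theta> (q ^ 2) (q * a ^ 2 * z)))) UNIV"
    using has_sum_cmult_right[OF prod[of z "q * a ^ 2 * z" "q ^ 2"], of "2 * a"] q q2 nz
    by (simp add: E_def case_prod_unfold)
  ultimately show ?thesis by (auto intro: has_sum_unique)
qed

section \<open>Passage to base q^2 and the difference of the two series\<close>

lemma qpoch_inf_mult_neg: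
  assumes "norm q < 1"
  shows "qpoch_inf x q * qpoch_inf (- x) q = qpoch_inf (x ^ 2) (q ^ 2)"
proof -
  have q2: "norm (q ^ 2) < 1"
    using assms by (simp add: norm_power power_less_one_iff)
  have "qfac x q n * qfac (- x) q n = qfac (x ^ 2) (q ^ 2) n" for n
    by (induction n) (simp_all add: power2_eq_square power_mult_distrib algebra_simps)
  then have "(\<lambda>n. qfac x q n * qfac (- x) q n) \<longlonglongrightarrow> qpoch_inf (x ^ 2) (q ^ 2)"
    using qfac_LIMSEQ[OF q2, of "x ^ 2"] by simp
  moreover have "(\<lambda>n. qfac x q n * qfac (- x) q n) \<longlonglongrightarrow> qpoch_inf x q * qpoch_inf (- x) q"
    by (intro tendsto_mult qfac_LIMSEQ assms)
  ultimately show ?thesis by (rule LIMSEQ_unique[symmetric])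
qed

lemma qpoch_inf_split:
  assumes "norm q < 1"
  shows "qpoch_inf x q = qpoch_inf x (q ^ 2) * qpoch_inf (x * q) (q ^ 2)"
proof -
  have q2: "norm (q ^ 2) < 1"
    using assms by (simp add: norm_power power_less_one_iff)
  have "qfac x q (n + n) = qfac x (q ^ 2) n * qfac (x * q) (q ^ 2) n" for n
    by (induction n) (simp_all add: power_add power_mult_distrib power2_eq_square mult_ac)
  then have "(\<lambda>n. qfac x q (n + n)) \<longlonglongrightarrow> qpoch_inf x (q ^ 2) * qpoch_inf (x * q) (q ^ 2)"
    using tendsto_mult[OF qfac_LIMSEQ[OF q2, of x] qfac_LIMSEQ[OF q2, of "x * q"]] by simp
  then show ?thesis
    using LIMSEQ_unique qfac_LIMSEQ_double[OF assms] by blast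
qed

text \<open>For the pair (c, q / c) Ramanujan's product, suitably normalised, depends on c only
  through c^2 apart from a theta quotient. So c = a and c = -a share a prefactor, and
  \<open>theta_quadratic\<close> evaluates what is left.\<close>

lemma psi11_difference:
  assumes q: "q \<noteq> 0" "norm q < 1" and nz: "a \<noteq> 0" "z \<noteq> 0"
    and a: "\<And>k :: int. a \<noteq> q powi k" "\<And>k :: int. - a \<noteq> q powi k"
    and z: "norm (q / a ^ 2) < norm z" "norm z < 1"
  shows "1 / 2 * (qpoch_inf q (q ^ 2) / qpoch_inf (q ^ 2) (q ^ 2)) *
      (qpoch_inf (q / a) q / qpoch_inf a q * psi11 a (q / a) q z
       - qpoch_inf (q / - a) q / qpoch_inf (- a) q * psi11 (- a) (q / - a) q z)
    = a * (qpoch_inf (q / a ^ 2) (q ^ 2) / qpoch_inf (a ^ 2) (q ^ 2))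
      * (qpoch_inf (q ^ 2 / z) (q ^ 2) * qpoch_inf (q * a ^ 2 * z) (q ^ 2)
         / (qpoch_inf (q * z) (q ^ 2) * qpoch_inf (q ^ 2 / (a ^ 2 * z)) (q ^ 2)))"
proof -
  define th where "th p x = qpoch_inf x p * qpoch_inf (p / x) p" for p x
  have q2: "q ^ 2 \<noteq> 0" "norm (q ^ 2) < 1"
    using q by (simp_all add: norm_power power_less_one_iff)
  \<comment> \<open>One factor (q/c; q) cancels against the normalisation, and division by (c; q)
    completes the denominator to \<open>th q c\<close>.\<close>
  have summand: "qpoch_inf (q / c) q / qpoch_inf c q * psi11 c (q / c) q z =
      qpoch_inf q q * qpoch_inf (q / a ^ 2) q / (qpoch_inf z q * qpoch_inf (q / (a ^ 2 * z)) q)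
        * (th q (c * z) / th q c)"
    if c: "c ^ 2 = a ^ 2" "\<And>k :: int. c \<noteq> q powi k" for c
  proof -
    have c0: "c \<noteq> 0" using c(1) nz by auto
    have "q / c \<noteq> q powi k" for k
    proof
      assume "q / c = q powi k"
      then have "c = q powi (1 - k)"
        using c0 q(1) by (simp add: power_int_diff field_simps)
      then show False using c(2) by blast
    qed
    then have psi: "psi11 c (q / c) q z =
      qpoch_inf q q * qpoch_inf (q / c / c) q * qpoch_inf (c * z) q * qpoch_inf (q / (c * z)) q /
      (qpoch_inf (q / c) q * qpoch_inf (q / c) q * qpoch_inf z q * qpoch_inf (q / c / (c * z)) q)"
      using c0 c q nz z by (intro Ramanujan_psi11) (auto simp flip: c(1) simp: power2_eq_square)
    have e: "q / c / c = q / a ^ 2" "q / c / (c * z) = q / (a ^ 2 * z)"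
      using c(1) by (simp_all add: power2_eq_square mult.assoc flip: c(1))
    have "qpoch_inf (q / c) q \<noteq> 0"
      using powi_neq_imp_power_neq(3)[OF c(2)] q(2) by (intro qpoch_inf_nonzero) auto
    then show ?thesis unfolding psi[unfolded e] by (simp add: th_def mult_ac)
  qed
  have th_nz: "th q c \<noteq> 0" if "\<And>k :: int. c \<noteq> q powi k" for c
    using powi_neq_imp_power_neq(2,3)[OF that] q(2) by (simp add: th_def qpoch_inf_nonzero)
  have thth: "th q a * th q (- a) = qpoch_inf (a ^ 2) (q ^ 2) * qpoch_inf (q ^ 2 / a ^ 2) (q ^ 2)"
    using qpoch_inf_mult_neg[OF q(2), of a] qpoch_inf_mult_neg[OF q(2), of "q / a"]
    by (simp add: th_def power_divide mult_ac)
  define Q where "Q = qpoch_inf q q"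
  define Q2 where "Q2 = qpoch_inf (q ^ 2) (q ^ 2)"
  define Q1 where "Q1 = qpoch_inf q (q ^ 2)"
  have Q: "Q = Q1 * Q2"
    unfolding Q_def Q1_def Q2_def using qpoch_inf_split[OF q(2), of q] by (simp add: power2_eq_square)
  have "q * q ^ k \<noteq> 1" for k
    using power_neq_1_of_norm_less_1[OF q(2), of "Suc k"] by simp
  then have "Q \<noteq> 0"
    unfolding Q_def by (intro qpoch_inf_nonzero q)
  with Q have Qnz: "Q1 \<noteq> 0" "Q2 \<noteq> 0" by auto
  \<comment> \<open>By the triple product each theta series is (p; p) times \<open>th p\<close>,
    hence \<open>Q ^ 2\<close> in base q and \<open>Q2 ^ 2\<close> in base q^2; as
    \<open>Q = Q1 * Q2\<close>, only \<open>Q1 ^ 2\<close> survives below.\<close>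
  have Qquad: "Q ^ 2 * (th q (a * z) * th q (- a) - th q (- (a * z)) * th q a)
     = 2 * a * (Q2 ^ 2 * (th (q ^ 2) z * th (q ^ 2) (q * a ^ 2 * z)))"
    using theta_quadratic[OF q nz] q q2 nz
    by (simp add: Jacobi_triple_product th_def Q_def Q2_def power2_eq_square algebra_simps)
  have quad: "th q (a * z) * th q (- a) - th q (- (a * z)) * th q a
     = 2 * a * (th (q ^ 2) z * th (q ^ 2) (q * a ^ 2 * z)) / Q1 ^ 2"
  proof -
    from Qquad have "Q2 ^ 2 * (Q1 ^ 2 * (th q (a * z) * th q (- a) - th q (- (a * z)) * th q a))
     = Q2 ^ 2 * (2 * a * (th (q ^ 2) z * th (q ^ 2) (q * a ^ 2 * z)))"
      by (simp add: Q power_mult_distrib mult_ac)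
    then show ?thesis
      using Qnz by (simp add: eq_divide_eq mult.commute)
  qed
  define W where "W = qpoch_inf (q / a ^ 2) q / (qpoch_inf z q * qpoch_inf (q / (a ^ 2 * z)) q)"
  have "qpoch_inf (q / a) q / qpoch_inf a q * psi11 a (q / a) q z
       - qpoch_inf (q / - a) q / qpoch_inf (- a) q * psi11 (- a) (q / - a) q z
     = Q * W * (th q (a * z) / th q a - th q (- (a * z)) / th q (- a))"
    by (simp only: summand[OF refl a(1)] summand[OF _ a(2)] power2_minus W_def Q_def right_diff_distrib
          mult_minus_left times_divide_eq_right)
  also have "th q (a * z) / th q a - th q (- (a * z)) / th q (- a)
     = (th q (a * z) * th q (- a) - th q (- (a * z)) * th q a) / (th q a * th q (- a))"
    using th_nz a by (simp add: diff_divide_eq_iff divide_diff_eq_iff mult_ac)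
  also have "\<dots> = 2 * a * (th (q ^ 2) z * th (q ^ 2) (q * a ^ 2 * z)) / (Q1 ^ 2 * (th q a * th q (- a)))"
    by (simp add: quad)
  \<comment> \<open>The constants collapse: (1/2)(Q1/Q2) times Q1 Q2 times 2a / Q1^2 is a.\<close>
  finally have "1 / 2 * (Q1 / Q2) * (qpoch_inf (q / a) q / qpoch_inf a q * psi11 a (q / a) q z
       - qpoch_inf (q / - a) q / qpoch_inf (- a) q * psi11 (- a) (q / - a) q z)
     = a * W * (th (q ^ 2) z * th (q ^ 2) (q * a ^ 2 * z)) / (th q a * th q (- a))"
    using Qnz by (simp add: Q field_simps power2_eq_square)
  also note thth
  finally have main: "1 / 2 * (Q1 / Q2) * (qpoch_inf (q / a) q / qpoch_inf a q * psi11 a (q / a) q z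
       - qpoch_inf (q / - a) q / qpoch_inf (- a) q * psi11 (- a) (q / - a) q z)
     = a * W * (th (q ^ 2) z * th (q ^ 2) (q * a ^ 2 * z)) / (qpoch_inf (a ^ 2) (q ^ 2) * qpoch_inf (q ^ 2 / a ^ 2) (q ^ 2))" .
  have split: "qpoch_inf x q = qpoch_inf x (q ^ 2) * qpoch_inf (q * x) (q ^ 2)" for x
    using qpoch_inf_split[OF q(2), of x] by (simp add: mult.commute)
  \<comment> \<open>Base q^2 exposes the cancellations: (q^2/a^2) against the denominator from
    \<open>thth\<close>, (z) and (q/(a^2 z)) against the two theta products.\<close>
  have W: "W = qpoch_inf (q / a ^ 2) (q ^ 2) * qpoch_inf (q ^ 2 / a ^ 2) (q ^ 2) /
     ((qpoch_inf z (q ^ 2) * qpoch_inf (q * z) (q ^ 2)) *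
      (qpoch_inf (q / (a ^ 2 * z)) (q ^ 2) * qpoch_inf (q ^ 2 / (a ^ 2 * z)) (q ^ 2)))"
    unfolding W_def split by (simp add: power2_eq_square)
  have th2: "th (q ^ 2) (q * a ^ 2 * z) = qpoch_inf (q * a ^ 2 * z) (q ^ 2) * qpoch_inf (q / (a ^ 2 * z)) (q ^ 2)"
    using q nz by (simp add: th_def power2_eq_square mult.assoc)
  \<comment> \<open>Nonvanishing of what is cancelled; through \<open>split\<close> a nonzero
    product in base q has nonzero halves in base q^2.\<close>
  have "qpoch_inf z q \<noteq> 0"
    using z q(2) by (intro qpoch_inf_nonzero mult_power_neq_1_of_norm_less_1)
  moreover have "norm (q / (a ^ 2 * z)) < 1"
    using z nz by (simp add: norm_divide norm_mult field_simps)
  then have "qpoch_inf (q / (a ^ 2 * z)) q \<noteq> 0"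
    using q(2) by (intro qpoch_inf_nonzero mult_power_neq_1_of_norm_less_1)
  moreover have "qpoch_inf (a ^ 2) (q ^ 2) * qpoch_inf (q ^ 2 / a ^ 2) (q ^ 2) \<noteq> 0"
    using th_nz a thth by (metis mult_eq_0_iff)
  ultimately show ?thesis
    using main unfolding split Q1_def[symmetric] Q2_def[symmetric] W th2 by (simp add: th_def mult_ac)
qed

theorem theorem2:
  fixes q s \<alpha> \<beta> \<gamma> w :: complex
  assumes "0 < norm q" and "norm q < 1"
    and "s ^ 2 = q"
    and "\<alpha> \<noteq> 0" and "\<beta> \<noteq> 0" and "\<gamma> \<noteq> 0"
    and "\<alpha> * \<beta> ^ 2 = - 1"
    and "\<beta> * \<gamma> = q"
    and "\<forall>k :: int. (\<alpha> * \<beta>) ^ 2 \<noteq> q powi (2 * k)"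
    and "w \<noteq> 0"
    and "norm (\<gamma> / (\<alpha> ^ 2 * \<beta>)) < norm (\<gamma> * w / (\<alpha> * s))"
    and "norm (\<gamma> * w / (\<alpha> * s)) < 1"
  shows "1 / 2 * (qpoch_inf q (q ^ 2) / qpoch_inf (q ^ 2) (q ^ 2)) *
      (qpoch_inf (\<gamma> / \<alpha>) q / qpoch_inf (\<alpha> * \<beta>) q
          * psi11 (\<alpha> * \<beta>) (\<gamma> / \<alpha>) q (\<gamma> * w / (\<alpha> * s))
       - qpoch_inf (\<beta> ^ 2 * \<gamma>) q / qpoch_inf (1 / \<beta>) q
          * psi11 (1 / \<beta>) (\<beta> ^ 2 * \<gamma>) q (\<gamma> * w / (\<alpha> * s)))
    = \<alpha> * \<beta>
      * (qpoch_inf (\<gamma> / (\<alpha> ^ 2 * \<beta>)) (q ^ 2) / qpoch_inf (\<alpha> ^ 2 * \<beta> ^ 2) (q ^ 2))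
      * (qpoch_inf (\<alpha> * s / (\<gamma> * w) * q ^ 2) (q ^ 2)
           * qpoch_inf (\<alpha> * \<beta> * w / s * q ^ 2) (q ^ 2)
         / (qpoch_inf (\<gamma> * w * s / \<alpha>) (q ^ 2)
           * qpoch_inf (q * s / (\<alpha> * \<beta> * w)) (q ^ 2)))"
proof -
  define a z where "a = \<alpha> * \<beta>" and "z = \<gamma> * w / (\<alpha> * s)"
  note as = assms
  have q0: "q \<noteq> 0" using as(1) by auto
  have s0: "s \<noteq> 0" using as(3) q0 by auto
  have a0: "a \<noteq> 0" and z0: "z \<noteq> 0" using as s0 by (simp_all add: a_def z_def)
  \<comment> \<open>The relations determine \<beta>, \<alpha> and \<gamma> by a alone.\<close>
  have "a * \<beta> = - 1" using as(7) by (simp add: a_def power2_eq_square mult.assoc)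
  then have \<beta>: "\<beta> = - 1 / a" using a0 by (simp add: field_simps)
  have \<alpha>: "\<alpha> = - (a ^ 2)"
    using a_def as(5) a0 unfolding \<beta> by (simp add: field_simps power2_eq_square)
  have "- \<gamma> = q * a" using as(8) a0 unfolding \<beta> by (simp add: field_simps)
  then have \<gamma>: "\<gamma> = - q * a" by (metis minus_minus mult_minus_left)
  \<comment> \<open>As q = s^2, the definition of z reduces to s w / a.\<close>
  have w: "w = a * z / s"
    using a0 q0 s0 as(3) unfolding z_def \<alpha> \<gamma> by (simp add: field_simps power2_eq_square)
  \<comment> \<open>Stated for any c with the same square, so that it serves both a and -a.\<close>
  have sq: "c \<noteq> q powi k" if "c ^ 2 = a ^ 2" for c and k :: int
  proof
    assume "c = q powi k"
    then have "a ^ 2 = q powi (k * 2)"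
      using that by (simp add: power_int_mult)
    then show False using as(9) unfolding a_def by (metis mult.commute)
  qed
  \<comment> \<open>Some left-hand sides contain a already, since
    \<open>\<alpha> * \<beta> = a\<close> rewrites those subterms first; \<open>q / - a\<close> is
    kept to match \<open>psi11_difference\<close>.\<close>
  have e: "\<gamma> / \<alpha> = q / a" "\<alpha> * \<beta> = a" "\<beta> ^ 2 * \<gamma> = q / - a" "1 / \<beta> = - a"
    "\<gamma> / (\<alpha> ^ 2 * \<beta>) = q / a ^ 2" "\<alpha> ^ 2 * \<beta> ^ 2 = a ^ 2" "\<gamma> * w / (\<alpha> * s) = z"
    "\<alpha> * s / (\<gamma> * w) * q ^ 2 = q ^ 2 / z" "a * w / s * q ^ 2 = q * a ^ 2 * z"
    "\<gamma> * w * s / \<alpha> = q * z" "q * s / (a * w) = q ^ 2 / (a ^ 2 * z)"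
    using a0 z0 s0 q0 unfolding \<beta> \<alpha> \<gamma> w as(3)[symmetric] 
    by (simp_all add: field_simps power2_eq_square)
  show ?thesis
    using as(11,12) unfolding e
    by (intro psi11_difference[OF q0 as(2) a0 z0] sq) simp_all
qed

end
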